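(* Let $r>1$ be a fixed integer and, for each integer $s\ge 2$, let $L_{r,s}$ be the smallest value obtained in $r$ rolls of a fair $s$-sided die. Then $$\lim_{s\to\infty}\frac{E[L_{r,s}]}{s}=\frac{1}{r+1}.$$
   Context: A fair $s$-sided die takes each value in $\{1,\dots,s\}$ with equal probability. A disadvantage experiment consists of rolling the die $r$ times (independently, so that all $s^r$ sequences in $\{1,\dots,s\}^r$ are equally likely) and taking the smallest number rolled as the outcome. $L_{r,s}$ is the random variable giving this outcome, i.e. $L_{r,s}=\min(X_1,\dots,X_r)$ with $X_1,\dots,X_r$ independent and uniform on $\{1,\dots,s\}$. *)

theory Defs
  imports "HOL-Probability.Probability"
begin

text \<open>
  A die with 0 sides does not exist: since \<open>pmf_of_set {}\<close> is unspecified,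
  \<open>die s\<close> is meaningful only for \<open>s \<ge> 1\<close>.
\<close>
definition die :: "nat \<Rightarrow> nat pmf" where
  "die s = pmf_of_set {1..s}"

text \<open>
  An outcome is a function \<open>X\<close> whose value \<open>X i\<close>, for \<open>i \<in> {1..r}\<close>, is the \<open>i\<close>-th roll;
  outside \<open>{1..r}\<close> it is constantly the dummy value 0. The coordinates in \<open>{1..r}\<close>
  are independent and each is distributed as \<open>die s\<close>.
\<close>
definition rolls :: "nat \<Rightarrow> nat \<Rightarrow> (nat \<Rightarrow> nat) pmf" where
  "rolls r s = Pi_pmf {1..r} 0 (\<lambda>_. die s)"

definition lowest :: "nat \<Rightarrow> (nat \<Rightarrow> nat) \<Rightarrow> nat" where
  "lowest r X = Min (X ` {1..r})"

end

theory Submission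
  imports Defs
begin

text \<open>
  Writing the outcome as a sum of indicators of \<open>k \<le> L\<close> gives
  \<open>E[L] = (\<Sum>j=1..s. (j / s) ^ r)\<close>, since all rolls are at least \<open>k\<close> with probability
  \<open>((s + 1 - k) / s) ^ r\<close>. Telescoping the two Bernoulli-type bounds below squeezes
  \<open>(r + 1) * (\<Sum>j=1..s. j ^ r)\<close> between \<open>s ^ (r + 1)\<close> and \<open>(s + 1) ^ (r + 1)\<close>.
\<close>

text \<open>A mean value bound with the derivative taken at the right endpoint. By induction on
  \<open>r\<close>: multiplying by \<open>x + 1\<close> leaves an extra \<open>x ^ Suc r\<close>,
  which is at most \<open>(x + 1) ^ Suc r\<close>.\<close>

lemma power_Suc_add_one_upper:
  fixes x :: real
  assumes "x \<ge> 0"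
  shows "(x + 1) ^ Suc r \<le> x ^ Suc r + (real r + 1) * (x + 1) ^ r"
proof (induction r)
  case (Suc r)
  have "(x + 1) ^ Suc (Suc r) \<le> (x + 1) * (x ^ Suc r + (real r + 1) * (x + 1) ^ r)"
    using mult_left_mono[OF Suc, of "x + 1"] assms by simp
  also have "\<dots> = x ^ Suc (Suc r) + x ^ Suc r + (real r + 1) * (x + 1) ^ Suc r"
    by (simp add: algebra_simps)
  also have "\<dots> \<le> x ^ Suc (Suc r) + (real (Suc r) + 1) * (x + 1) ^ Suc r"
    using power_mono[of x "x + 1" "Suc r"] assms by (simp add: distrib_right)
  finally show ?case .
qed simp

text \<open>The counterpart at the left endpoint. Here multiplying by \<open>x + 1\<close> produces
  the surplus \<open>(real r + 1) * x ^ r\<close>, which is nonnegative and is dropped.\<close>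

lemma power_Suc_add_one_lower:
  fixes x :: real
  assumes "x \<ge> 0"
  shows "x ^ Suc r + (real r + 1) * x ^ r \<le> (x + 1) ^ Suc r"
proof (induction r)
  case (Suc r)
  have "x ^ Suc (Suc r) + (real (Suc r) + 1) * x ^ Suc r
      \<le> (x + 1) * (x ^ Suc r + (real r + 1) * x ^ r)"
    using assms by (simp add: algebra_simps)
  also have "\<dots> \<le> (x + 1) ^ Suc (Suc r)"
    using mult_left_mono[OF Suc, of "x + 1"] assms by simp
  finally show ?case .
qed simp

lemma sum_powers_lower: "real s ^ Suc r \<le> (real r + 1) * (\<Sum>j=1..s. real j ^ r)"
proof (induction s)
  case (Suc s)
  then show ?case
    using power_Suc_add_one_upper[of "real s" r] by (simp add: algebra_simps)
qed simp

lemma sum_powers_upper: "(real r + 1) * (\<Sum>j=1..s. real j ^ r) \<le> (real s + 1) ^ Suc r"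
proof (induction s)
  case (Suc s)
  \<comment> \<open>The new summand \<open>real (Suc s) ^ r\<close> must be the left-endpoint
    derivative, so the bound is taken at \<open>Suc s\<close>; this shift is why
    \<open>real s + 1\<close> appears on the right.\<close>
  then show ?case
    using power_Suc_add_one_lower[of "real (Suc s)" r] by (simp add: algebra_simps)
qed simp

lemma sum_powers_asymptotic:
  "(\<lambda>s. (\<Sum>j=1..s. real j ^ r) / real s ^ Suc r) \<longlonglongrightarrow> 1 / (real r + 1)"
proof (rule tendsto_sandwich)
  show "\<forall>\<^sub>F s in sequentially. 1 / (real r + 1) \<le> (\<Sum>j=1..s. real j ^ r) / real s ^ Suc r"
    using eventually_gt_at_top[of 0]
  proof eventually_elim
    case (elim s)
    then show ?case
      using sum_powers_lower[of s r] by (simp add: field_simps)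
  qed
  \<comment> \<open>The ratio of \<open>(real s + 1) ^ Suc r\<close> to
    \<open>real s ^ Suc r\<close> is written as a power of \<open>1 + 1 / real s\<close>, whose
    exponent is fixed, so its limit is immediate.\<close>
  show "\<forall>\<^sub>F s in sequentially. (\<Sum>j=1..s. real j ^ r) / real s ^ Suc r
      \<le> (1 + 1 / real s) ^ Suc r / (real r + 1)"
    using eventually_gt_at_top[of 0]
  proof eventually_elim
    case (elim s)
    have "1 + 1 / real s = (real s + 1) / real s"
      using elim by (simp add: field_simps)
    then have "(1 + 1 / real s) ^ Suc r = (real s + 1) ^ Suc r / real s ^ Suc r"
      by (simp only: power_divide)
    moreover have "(\<Sum>j=1..s. real j ^ r) \<le> (real s + 1) ^ Suc r / (real r + 1)"
      using sum_powers_upper[of r s] by (simp add: field_simps)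
    then have "(\<Sum>j=1..s. real j ^ r) / real s ^ Suc r
        \<le> (real s + 1) ^ Suc r / (real r + 1) / real s ^ Suc r"
      by (rule divide_right_mono) simp
    ultimately show ?case
      by (simp add: field_simps del: power_Suc)
  qed
  have "(\<lambda>s. (1 + 1 / real s) ^ Suc r / (real r + 1)) \<longlonglongrightarrow> (1 + 0) ^ Suc r / (real r + 1)"
    by (intro tendsto_intros lim_const_over_n) simp
  then show "(\<lambda>s. (1 + 1 / real s) ^ Suc r / (real r + 1)) \<longlonglongrightarrow> 1 / (real r + 1)"
    by simp
qed simp

lemma set_pmf_rolls:
  assumes "s \<ge> 1"
  shows "set_pmf (rolls r s) = PiE_dflt {1..r} 0 (\<lambda>_. {1..s})"
  using assms by (simp add: rolls_def set_Pi_pmf die_def comp_def)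

text \<open>With \<open>r \<ge> 1\<close> the set of rolls is nonempty, so \<open>Min\<close> is a
  genuine minimum.\<close>

lemma lowest_ge_iff:
  assumes "r \<ge> 1"
  shows "k \<le> lowest r X \<longleftrightarrow> (\<forall>i\<in>{1..r}. k \<le> X i)"
  using assms by (simp add: lowest_def)

lemma prob_die_ge:
  assumes "k \<in> {1..s}"
  shows "measure_pmf.prob (die s) {k..} = real (s + 1 - k) / real s"
proof -
  have "{1..s} \<inter> {k..} = {k..s}"
    using assms by auto
  then show ?thesis
    using assms by (simp add: die_def measure_pmf_of_set)
qed

lemma prob_lowest_ge:
  assumes "r \<ge> 1" and "k \<in> {1..s}"
  shows "measure_pmf.prob (rolls r s) {X. k \<le> lowest r X} = (real (s + 1 - k) / real s) ^ r"
proof -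
  \<comment> \<open>As a product event, its probability factors by independence into
    \<open>r\<close> equal terms.\<close>
  have "{X. k \<le> lowest r X} = Pi {1..r} (\<lambda>_. {k..})"
    using lowest_ge_iff[OF assms(1)] by auto
  then show ?thesis
    using prob_die_ge[OF assms(2)] by (simp add: rolls_def measure_Pi_pmf_Pi)
qed

lemma expectation_lowest:
  assumes "r \<ge> 1" and "s \<ge> 1"
  shows "measure_pmf.expectation (rolls r s) (\<lambda>X. real (lowest r X))
    = (\<Sum>j=1..s. (real j / real s) ^ r)"
proof -
  let ?E = "measure_pmf.expectation (rolls r s)"
  have fin: "finite (set_pmf (rolls r s))"
    using assms(2) by (simp add: set_pmf_rolls finite_PiE_dflt)
  have "?E (\<lambda>X. real (lowest r X)) = ?E (\<lambda>X. \<Sum>k=1..s. indicator {X. k \<le> lowest r X} X)"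
  \<comment> \<open>The identity is needed only on the support, where rolls are at most
    \<open>s\<close>; elsewhere the sum cut off at \<open>s\<close> could fall short of the
    minimum.\<close>
  proof (intro integral_cong_AE AE_pmfI)
    fix X assume "X \<in> set_pmf (rolls r s)"
    then have X: "\<forall>i\<in>{1..r}. X i \<le> s"
      using assms(2) by (auto simp: set_pmf_rolls PiE_dflt_def)
    \<comment> \<open>Any single roll bounds the minimum; roll 1 exists because
      \<open>r \<ge> 1\<close>.\<close>
    have "lowest r X \<le> X 1"
      using lowest_ge_iff[OF assms(1), of "lowest r X" X] assms(1) by simp
    also have "X 1 \<le> s"
      using X assms(1) by simp
    finally have "{k \<in> {1..s}. k \<le> lowest r X} = {1..lowest r X}"
      by auto
    then show "real (lowest r X) = (\<Sum>k=1..s. indicator {X. k \<le> lowest r X} X)"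
      by (simp add: indicator_def of_bool_def sum.If_cases Int_def)
  qed simp_all
  also have "\<dots> = (\<Sum>k=1..s. ?E (indicator {X. k \<le> lowest r X}))"
    by (rule Bochner_Integration.integral_sum) (rule integrable_measure_pmf_finite[OF fin])
  also have "\<dots> = (\<Sum>k=1..s. (real (s + 1 - k) / real s) ^ r)"
    using assms(1) by (intro sum.cong refl) (simp add: prob_lowest_ge)
  \<comment> \<open>Reverse the order of summation: \<open>j = s + 1 - k\<close> is an involution of
    \<open>{1..s}\<close>.\<close>
  also have "\<dots> = (\<Sum>j=1..s. (real j / real s) ^ r)"
    by (rule sum.reindex_bij_witness[of _ "\<lambda>j. s + 1 - j" "\<lambda>j. s + 1 - j"]) auto
  finally show ?thesis .
qed

theorem corollary3p1p1:
  fixes r :: nat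
  assumes "r > 1"
  shows "(\<lambda>s::nat. measure_pmf.expectation (rolls r s) (\<lambda>X. real (lowest r X)) / real s)
           \<longlonglongrightarrow> 1 / (real r + 1)"
proof (rule Lim_transform_eventually[OF sum_powers_asymptotic])
  show "\<forall>\<^sub>F s in sequentially. (\<Sum>j=1..s. real j ^ r) / real s ^ Suc r
      = measure_pmf.expectation (rolls r s) (\<lambda>X. real (lowest r X)) / real s"
    \<comment> \<open>This discards \<open>s = 0\<close>, where \<open>die s\<close> is unspecified.
      For the rest, dividing the expectation by \<open>s\<close> raises the denominator from
      \<open>s ^ r\<close> to \<open>s ^ Suc r\<close>.\<close>
    using eventually_ge_at_top[of 1]
  proof eventually_elim
    case (elim s)
    then show ?case
      using assms
      by (simp add: expectation_lowest power_divide mult.commute flip: sum_divide_distrib)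
  qed
qed

end
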